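(* Let $\mathcal{A}$ be a finite-dimensional ternary Jordan algebra over a field $\mathrm{F}$ with $\operatorname{char}\mathrm{F}\neq 2$, such that $[\![\mathcal{A},\mathcal{A},\mathcal{A}]\!]\neq 0$ and $QDer(\mathcal{A})=gl(\mathcal{A})$. Then $\dim(\mathcal{A})\leq 2$. Moreover: (1) if $\dim(\mathcal{A})=1$, then $\mathcal{A}$ is a simple ternary Jordan algebra; (2) if $\dim(\mathcal{A})=2$, then $[\![\mathcal{A},\mathcal{A},\mathcal{A}]\!]=\mathcal{A}$.
   Context: A ternary Jordan algebra over a field $\mathrm{F}$ is an $\mathrm{F}$-vector space $\mathcal{A}$ with a trilinear map $[\![\cdot,\cdot,\cdot]\!]:\mathcal{A}^3\to\mathcal{A}$ that is invariant under all permutations of its arguments and such that for all $x_2,x_3,y_2,y_3\in\mathcal{A}$ the commutator $[R_{(x_2,x_3)},R_{(y_2,y_3)}]$ is a derivation of $\mathcal{A}$, where $R_{(y_2,y_3)}(y)=[\![y,y_2,y_3]\!]$; a derivation is a linear map $D$ with $D([\![x,y,z]\!])=[\![D(x),y,z]\!]+[\![x,D(y),z]\!]+[\![x,y,D(z)]\!]$ for all $x,y,z$. $[\![\mathcal{A},\mathcal{A},\mathcal{A}]\!]$ denotes the linear span of all products. $QDer(\mathcal{A})$ (quasiderivations) is the set of linear maps $f:\mathcal{A}\to\mathcal{A}$ for which there is a linear map $f':\mathcal{A}\to\mathcal{A}$ with $[\![f(x),y,z]\!]+[\![x,f(y),z]\!]+[\![x,y,f(z)]\!]=f'([\![x,y,z]\!])$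 for all $x,y,z$. $gl(\mathcal{A})$ is the space of all linear maps $\mathcal{A}\to\mathcal{A}$. An ideal is a subspace $\mathcal{I}$ with $[\![\mathcal{I},\mathcal{A},\mathcal{A}]\!]\subseteq\mathcal{I}$. $\mathcal{A}$ is simple if $[\![\mathcal{A},\mathcal{A},\mathcal{A}]\!]\neq 0$ and its only ideals are $0$ and $\mathcal{A}$. *)

theory Defs
  imports Complex_Main
begin

text \<open>
  The algebra is the whole type \<open>'v\<close>, regarded as a vector space over \<open>'f\<close> by means of \<open>scale\<close>.
\<close>

locale ternary_algebra = vector_space scale
  for scale :: "'f::field \<Rightarrow> 'v::ab_group_add \<Rightarrow> 'v" +
  fixes tprod :: "'v \<Rightarrow> 'v \<Rightarrow> 'v \<Rightarrow> 'v"
  assumes linear_fst: "Vector_Spaces.linear scale scale (\<lambda>x. tprod x y z)"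
    and linear_snd: "Vector_Spaces.linear scale scale (\<lambda>y. tprod x y z)"
    and linear_trd: "Vector_Spaces.linear scale scale (\<lambda>z. tprod x y z)"
begin

definition tprod_span :: "'v set \<Rightarrow> 'v set \<Rightarrow> 'v set \<Rightarrow> 'v set" where
  "tprod_span X Y Z = span {tprod x y z | x y z. x \<in> X \<and> y \<in> Y \<and> z \<in> Z}"

definition gl :: "('v \<Rightarrow> 'v) set" where
  "gl = {f. Vector_Spaces.linear scale scale f}"

definition derivation :: "('v \<Rightarrow> 'v) \<Rightarrow> bool" where
  "derivation D \<longleftrightarrow> D \<in> gl \<and>
     (\<forall>x y z. D (tprod x y z) = tprod (D x) y z + tprod x (D y) z + tprod x y (D z))"

definition QDer :: "('v \<Rightarrow> 'v) set" where
  "QDer = {f \<in> gl. \<exists>f' \<in> gl. \<forall>x y z.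
     tprod (f x) y z + tprod x (f y) z + tprod x y (f z) = f' (tprod x y z)}"

definition right_mult :: "'v \<Rightarrow> 'v \<Rightarrow> 'v \<Rightarrow> 'v" where
  "right_mult y2 y3 = (\<lambda>y. tprod y y2 y3)"

definition commutator :: "('v \<Rightarrow> 'v) \<Rightarrow> ('v \<Rightarrow> 'v) \<Rightarrow> 'v \<Rightarrow> 'v" where
  "commutator f g = (\<lambda>x. f (g x) - g (f x))"

definition tideal :: "'v set \<Rightarrow> bool" where
  "tideal I \<longleftrightarrow> subspace I \<and> tprod_span I UNIV UNIV \<subseteq> I"

end

locale ternary_jordan_algebra = ternary_algebra +
  assumes symmetric:
      "tprod x y z = tprod x z y" "tprod x y z = tprod y x z" "tprod x y z = tprod y z x"
      "tprod x y z = tprod z x y" "tprod x y z = tprod z y x"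
    and commutator_derivation:
      "derivation (commutator (right_mult x2 x3) (right_mult y2 y3))"

locale simple_ternary_jordan_algebra = ternary_jordan_algebra +
  assumes nonzero_product: "tprod_span UNIV UNIV UNIV \<noteq> {0}"
    and trivial_ideals: "{I. tideal I} = {{0}, UNIV}"

end

theory Submission
  imports Defs
begin

text \<open>
  If every linear map is a quasiderivation, then for every linear \<open>f\<close> the vanishing of a product
  \<open>tprod x y z\<close> forces \<open>tprod (f x) y z + tprod x (f y) z + tprod x y (f z) = 0\<close>. Applied to
  elementary maps on a basis \<open>B\<close>, this shows that if one product \<open>tprod i i k\<close> with distinct
  \<open>i, k \<in> B\<close> vanishes, then the whole product does. The maps \<open>f'\<close> belonging to the projections
  onto basis vectors have the \<open>tprod i i k\<close> as eigenvectors with pairwise different weights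
  (as \<open>2 \<noteq> 0\<close>), so these \<open>n * (n - 1)\<close> vectors are linearly independent, where \<open>n = card B\<close>.
  Hence \<open>n \<le> 2\<close>, and for \<open>n = 2\<close> they span the algebra.
\<close>

lemma two_neq_0_of_CHAR:
  assumes "CHAR('f::field) \<noteq> 2"
  shows "(2::'f) \<noteq> 0"
proof
  assume "(2::'f) = 0"
  then have "CHAR('f) dvd 2"
    using of_nat_eq_0_iff_char_dvd[where ?'a = 'f, of 2] by simp
  moreover from this have "CHAR('f) \<le> 2"
    by (simp add: dvd_imp_le)
  moreover have "CHAR('f) \<noteq> 1"
    using CHAR_not_1' by simp
  ultimately show False
    using assms by (cases "CHAR('f) = 0") auto
qed

context vector_space
begin

text \<open>A member in the span of the others would be killed by its own separating map
  \<open>G\<close>. Injectivity is recorded as well, so that the members can be counted by their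
  indices.\<close>

lemma independent_family:
  assumes "\<And>i. i \<in> I \<Longrightarrow> \<exists>G. Vector_Spaces.linear scale scale G \<and> G (v i) \<noteq> 0 \<and>
              (\<forall>j\<in>I. j \<noteq> i \<longrightarrow> G (v j) = 0)"
  shows "inj_on v I" and "independent (v ` I)"
proof -
  interpret vector_space_pair scale scale ..
  show "inj_on v I"
    using assms by (metis inj_onI)
  show "independent (v ` I)"
    unfolding dependent_def
  proof clarify
    fix i assume i: "i \<in> I" and dep: "v i \<in> span (v ` I - {v i})"
    obtain G where G: "Vector_Spaces.linear scale scale G" "G (v i) \<noteq> 0"
        "\<forall>j\<in>I. j \<noteq> i \<longrightarrow> G (v j) = 0"
      using assms i by blast
    have "G x = 0" if "x \<in> v ` I - {v i}" for x
      using that G(3) by auto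
    then have "G (v i) = 0"
      using linear_eq_0_on_span[OF G(1) _ dep] by blast
    with G(2) show False ..
  qed
qed

end

context ternary_algebra
begin

sublocale end_pair: vector_space_pair scale scale ..

lemma tprod_zero [simp]: "tprod 0 y z = 0" "tprod x 0 z = 0" "tprod x y 0 = 0"
  using linear_fst linear_snd linear_trd by (fast dest: end_pair.linear_0)+

lemma tprod_eq_0_if_0_on_spanning:
  assumes "span B = UNIV" and "\<And>x y z. x \<in> B \<Longrightarrow> y \<in> B \<Longrightarrow> z \<in> B \<Longrightarrow> tprod x y z = 0"
  shows "tprod x y z = 0"
proof -
  have 1: "tprod x y z = 0" if "y \<in> B" "z \<in> B" for x y z
    by (rule end_pair.linear_eq_0_on_span[OF linear_fst, of B]) (use assms that in auto)
  have 2: "tprod x y z = 0" if "z \<in> B" for x y z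
    by (rule end_pair.linear_eq_0_on_span[OF linear_snd, of B]) (use assms 1 that in auto)
  show ?thesis
    by (rule end_pair.linear_eq_0_on_span[OF linear_trd, of B]) (use assms 2 in auto)
qed

lemma tideal_zero: "tideal {0}"
proof -
  have "{tprod x y z | x y z. x \<in> {0} \<and> y \<in> UNIV \<and> z \<in> UNIV} = {0}"
    by auto
  then show ?thesis
    unfolding tideal_def tprod_span_def by simp
qed

lemma tideal_UNIV: "tideal UNIV"
  unfolding tideal_def by simp

text \<open>With \<open>c = b\<close> this yields the projection onto a basis vector; an arbitrary
  \<open>c\<close> serves to exchange \<open>b\<close> for any vector inside a product.\<close>

lemma QDer_elementary:
  assumes "QDer = gl" and "independent B"
  obtains f f' where "\<And>x. x \<in> B \<Longrightarrow> f x = (if x = b then c else 0)"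
    and "Vector_Spaces.linear scale scale f'"
    and "\<And>x y z. f' (tprod x y z) = tprod (f x) y z + tprod x (f y) z + tprod x y (f z)"
proof -
  obtain f where f: "Vector_Spaces.linear scale scale f" "\<forall>x\<in>B. f x = (if x = b then c else 0)"
    using end_pair.linear_independent_extend[OF assms(2), of "\<lambda>x. if x = b then c else 0"] by blast
  then have "f \<in> QDer"
    using assms(1) gl_def by simp
  then obtain f' where "f' \<in> gl"
      "\<forall>x y z. tprod (f x) y z + tprod x (f y) z + tprod x y (f z) = f' (tprod x y z)"
    unfolding QDer_def by blast
  with f show thesis
    using that[of f f'] unfolding gl_def by (metis mem_Collect_eq)
qed

end

context ternary_jordan_algebra
begin

text \<open>The zero spreads from \<open>tprod i i k\<close>: elementary maps exchange first
  \<open>k\<close>, then one \<open>i\<close>, then the other for new vectors, until all products of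
  basis vectors vanish.\<close>

lemma tprod_eq_0_if_square_eq_0:
  assumes Q: "QDer = gl" and ind: "independent B" and spn: "span B = UNIV"
    and two: "\<And>x::'b. x + x = 0 \<Longrightarrow> x = 0"
    and ik: "i \<in> B" "k \<in> B" "i \<noteq> k" and zero: "tprod i i k = 0"
  shows "tprod x y z = 0"
proof -
  \<comment> \<open>Since \<open>f\<close> kills \<open>y\<close> and \<open>z\<close>, the only
    remaining term is \<open>tprod c y z\<close>, and it equals \<open>f' 0\<close>.\<close>
  have replace: "tprod c y z = 0"
    if "tprod b y z = 0" "b \<in> B" "y \<in> B" "z \<in> B" "b \<noteq> y" "b \<noteq> z" for b c y z
  proof -
    obtain f f' where f: "\<And>x. x \<in> B \<Longrightarrow> f x = (if x = b then c else 0)"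
      and f': "Vector_Spaces.linear scale scale f'"
        "\<And>x y z. f' (tprod x y z) = tprod (f x) y z + tprod x (f y) z + tprod x y (f z)"
      using QDer_elementary[OF Q ind] by blast
    show ?thesis
      using f'(2)[of b y z] f[of b] f[of y] f[of z] that end_pair.linear_0[OF f'(1)] by simp
  qed
  \<comment> \<open>Now \<open>f\<close> moves both copies of \<open>b\<close>. By symmetry the two
    terms add up to twice \<open>tprod b c z\<close>, hence the appeal to
    \<open>two\<close>.\<close>
  have replace_square: "tprod b c z = 0"
    if "tprod b b z = 0" "b \<in> B" "z \<in> B" "b \<noteq> z" for b c z
  proof -
    obtain f f' where f: "\<And>x. x \<in> B \<Longrightarrow> f x = (if x = b then c else 0)"
      and f': "Vector_Spaces.linear scale scale f'"
        "\<And>x y z. f' (tprod x y z) = tprod (f x) y z + tprod x (f y) z + tprod x y (f z)"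
      using QDer_elementary[OF Q ind] by blast
    have "tprod c b z + tprod b c z = 0"
      using f'(2)[of b b z] f[of b] f[of z] that end_pair.linear_0[OF f'(1)] by simp
    then show ?thesis
      using two[of "tprod b c z"] symmetric(2)[of c b z] by simp
  qed
  have 1: "tprod i i c = 0" for c
    using replace[of k i i c] zero ik symmetric(3)[of k i i] symmetric(3)[of c i i] by simp
  have 2: "tprod i y z = 0" if "z \<in> B" for y z
    using replace_square[of i z y] 1 symmetric(1)[of i y i] that ik by (cases "z = i") simp_all
  have 3: "tprod x y z = 0" if "y \<in> B" "z \<in> B" for x y z
  proof (cases "y = i \<or> z = i")
    case True
    then show ?thesis
      using 2 that ik symmetric(2)[of x i z] symmetric(4)[of x y i] symmetric(1)[of i x y] by auto
  next
    case False
    then show ?thesis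
      using replace[OF 2[OF that(2)] ik(1) that] by metis
  qed
  show ?thesis
    by (rule tprod_eq_0_if_0_on_spanning[OF spn 3])
qed

text \<open>Take \<open>f'\<close> from the projection onto \<open>i\<close> and \<open>g'\<close>
  from the one onto \<open>k\<close>: among the family only \<open>tprod i i k\<close> has weight 2
  for \<open>f'\<close> and weight 1 for \<open>g'\<close>.\<close>

lemma independent_squares:
  assumes Q: "QDer = gl" and ind: "independent B"
    and two: "\<And>x::'b. x + x = 0 \<Longrightarrow> x = 0"
    and nz: "\<And>i k. i \<in> B \<Longrightarrow> k \<in> B \<Longrightarrow> i \<noteq> k \<Longrightarrow> tprod i i k \<noteq> 0"
  defines "I \<equiv> SIGMA i:B. B - {i}" and "v \<equiv> \<lambda>(i, k). tprod i i k"
  shows "inj_on v I" and "independent (v ` I)"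
proof -
  have *: "\<exists>G. Vector_Spaces.linear scale scale G \<and> G (v p) \<noteq> 0 \<and>
              (\<forall>q\<in>I. q \<noteq> p \<longrightarrow> G (v q) = 0)" if "p \<in> I" for p
  proof -
    obtain i k where p: "p = (i, k)" and ik: "i \<in> B" "k \<in> B" "i \<noteq> k"
      using \<open>p \<in> I\<close> unfolding I_def by auto
    obtain f f' where f: "\<And>x. x \<in> B \<Longrightarrow> f x = (if x = i then i else 0)"
      and f': "Vector_Spaces.linear scale scale f'"
        "\<And>x y z. f' (tprod x y z) = tprod (f x) y z + tprod x (f y) z + tprod x y (f z)"
      using QDer_elementary[OF Q ind] by blast
    obtain g g' where g: "\<And>x. x \<in> B \<Longrightarrow> g x = (if x = k then k else 0)"
      and g': "Vector_Spaces.linear scale scale g'"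
        "\<And>x y z. g' (tprod x y z) = tprod (g x) y z + tprod x (g y) z + tprod x y (g z)"
      using QDer_elementary[OF Q ind] by blast
    \<comment> \<open>The weight of \<open>tprod a a b\<close> under \<open>f'\<close> is \<open>2\<close>, \<open>1\<close> or \<open>0\<close>, and \<open>f' (f' - 1)\<close> kills
        the weights \<open>0\<close> and \<open>1\<close>; then \<open>g'\<close> separates \<open>b = k\<close> from \<open>b \<noteq> k\<close>.\<close>
    define G where "G = (\<lambda>x. g' (f' (f' x - x)))"
    have "Vector_Spaces.linear scale scale G"
      unfolding G_def
      using Vector_Spaces.linear_compose[OF Vector_Spaces.linear_compose[OF
          end_pair.linear_compose_sub[OF f'(1) linear_id] f'(1)] g'(1)]
      by (simp add: o_def id_def)
    moreover have "G (v p) \<noteq> 0"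
    proof -
      have "f' (tprod i i k) = tprod i i k + tprod i i k" "g' (tprod i i k) = tprod i i k"
        using f'(2)[of i i k] f[of i] f[of k] g'(2)[of i i k] g[of i] g[of k] ik by simp_all
      \<comment> \<open>On weight 2 the map \<open>f' (f' - 1)\<close> is multiplication by
        \<open>2 * (2 - 1)\<close>, which is nonzero by \<open>two\<close>.\<close>
      then have "G (v p) = tprod i i k + tprod i i k"
        unfolding G_def v_def p using end_pair.linear_add[OF g'(1)] by simp
      then show ?thesis
        using nz ik two by metis
    qed
    moreover have "G (v q) = 0" if q: "q \<in> I" "q \<noteq> p" for q
    proof -
      obtain a b where ab: "q = (a, b)" "a \<in> B" "b \<in> B" "a \<noteq> b"
        using q(1) unfolding I_def by auto
      note zero = end_pair.linear_0[OF f'(1)] end_pair.linear_0[OF g'(1)]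
      have f'ab: "f' (tprod a a b) =
          (if a = i then tprod a a b + tprod a a b else if b = i then tprod a a b else 0)"
        using f'(2)[of a a b] f[of a] f[of b] ab by (cases "a = i"; cases "b = i") simp_all
      show ?thesis
      proof (cases "a = i")
        case True
        then have "b \<noteq> k" "a \<noteq> k"
          using ab(1) q(2) p ik by auto
        then have "g' (tprod a a b) = 0"
          using g'(2)[of a a b] g[of a] g[of b] ab by simp
        then show ?thesis
          using True f'ab ab(1) end_pair.linear_add[OF g'(1)] by (simp add: G_def v_def)
      next
        case False
        then show ?thesis
          using f'ab ab(1) zero end_pair.linear_neg[OF f'(1)] by (auto simp: G_def v_def)
      qed
    qed
    ultimately show ?thesis
      by blast
  qed
  show "inj_on v I" "independent (v ` I)"
    using independent_family[of I v] * by blast+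
qed

text \<open>A subspace of dimension 0 is zero and one of dimension at least 1 is everything, which
  leaves only the two trivial ideals.\<close>

lemma simple_if_dim_1:
  assumes "finite_dimensional_vector_space scale B"
    and "dim UNIV = 1" and "tprod_span UNIV UNIV UNIV \<noteq> {0}"
  shows "simple_ternary_jordan_algebra scale tprod"
proof -
  interpret fd: finite_dimensional_vector_space scale B by fact
  have "I = {0} \<or> I = UNIV" if "subspace I" for I
  proof (cases "dim I = 0")
    case True
    then have "I \<subseteq> {0}" by (simp add: fd.dim_eq_0)
    then show ?thesis using subspace_0[OF that] by blast
  next
    case False
    then have "dim UNIV \<le> dim I"
      unfolding assms(2) by linarith
    then show ?thesis
      using fd.subspace_dim_equal[OF that subspace_UNIV subset_UNIV] by blast
  qed
  then have "{I. tideal I} = {{0}, UNIV}"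
    using tideal_zero tideal_UNIV by (auto simp: tideal_def)
  with assms(3) show ?thesis
    by unfold_locales
qed

end

theorem theorem6p3:
  fixes scale :: "'f::field \<Rightarrow> 'v::ab_group_add \<Rightarrow> 'v"
    and tprod :: "'v \<Rightarrow> 'v \<Rightarrow> 'v \<Rightarrow> 'v"
  assumes "ternary_jordan_algebra scale tprod"
    and "\<exists>Basis. finite_dimensional_vector_space scale Basis"
    and "CHAR('f) \<noteq> 2"
    and "ternary_algebra.tprod_span scale tprod UNIV UNIV UNIV \<noteq> {0}"
    and "ternary_algebra.QDer scale tprod = ternary_algebra.gl scale"
  shows "vector_space.dim scale (UNIV :: 'v set) \<le> 2
    \<and> (vector_space.dim scale (UNIV :: 'v set) = 1 \<longrightarrow> simple_ternary_jordan_algebra scale tprod)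
    \<and> (vector_space.dim scale (UNIV :: 'v set) = 2 \<longrightarrow>
         ternary_algebra.tprod_span scale tprod UNIV UNIV UNIV = UNIV)"
proof -
  interpret ternary_jordan_algebra scale tprod by fact
  obtain B where fdB: "finite_dimensional_vector_space scale B"
    using assms(2) by blast
  interpret fd: finite_dimensional_vector_space scale B by fact
  have two: "x = 0" if "x + x = 0" for x :: 'v
  proof -
    have "scale 2 x = 0"
      using that scale_left_distrib[of 1 1 x] by simp
    then show ?thesis
      using two_neq_0_of_CHAR[OF assms(3)] by simp
  qed
  have ex: "\<exists>x y z. tprod x y z \<noteq> 0"
  proof (rule ccontr)
    assume "\<not> ?thesis"
    then have "{tprod x y z | x y z. x \<in> UNIV \<and> y \<in> UNIV \<and> z \<in> UNIV} = {0}"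
      by auto
    then show False
      using assms(4) unfolding tprod_span_def by simp
  qed
  define I where "I = (SIGMA i:B. B - {i})"
  define v where "v = (\<lambda>(i, k). tprod i i k)"
  have "tprod i i k \<noteq> 0" if "i \<in> B" "k \<in> B" "i \<noteq> k" for i k
    using tprod_eq_0_if_square_eq_0[OF assms(5) fd.independent_Basis fd.span_Basis two that] ex
    by blast
  then have v: "inj_on v I" "independent (v ` I)"
    using independent_squares[OF assms(5) fd.independent_Basis two] unfolding I_def v_def
    by blast+
  have dim: "dim UNIV = card B"
    using fd.dim_UNIV fd.dimension_def by simp
  have "card (v ` I) = card B * (card B - 1)"
    using card_image[OF v(1)] fd.finite_Basis by (simp add: I_def)
  then have card: "card (v ` I) = dim UNIV * (dim UNIV - 1)"
    using dim by simp
  \<comment> \<open>The factor 1 on the right is kept so that a nonzero \<open>dim UNIV\<close>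
    cancels, leaving \<open>dim UNIV - 1 \<le> 1\<close>.\<close>
  have "dim UNIV * (dim UNIV - 1) \<le> dim UNIV * 1"
    using fd.independent_card_le_dim[OF subset_UNIV v(2)] card by simp
  then have "dim UNIV \<le> 2"
    by (cases "dim UNIV = 0") (auto simp del: mult_1_right)
  moreover have "tprod_span UNIV UNIV UNIV = UNIV" if "dim UNIV = 2"
  proof -
    \<comment> \<open>In dimension 2 there are \<open>2 * (2 - 1)\<close> independent vectors in the
      family, exactly as many as the dimension.\<close>
    have "UNIV \<subseteq> span (v ` I)"
      using fd.card_ge_dim_independent[OF subset_UNIV v(2)] card that by simp
    also have "span (v ` I) \<subseteq> tprod_span UNIV UNIV UNIV"
      unfolding tprod_span_def by (rule span_mono) (auto simp: v_def)
    finally show ?thesis by blast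
  qed
  ultimately show ?thesis
    using simple_if_dim_1[OF fdB _ assms(4)] by blast
qed

end
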